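(* Let $\mathcal{H}$ be a real Hilbert space, $A:\mathcal{H}\to\mathcal{H}$ a single-valued operator and $B:\mathcal{H}\rightrightarrows\mathcal{H}$ a set-valued operator such that the solution set $S:=\{x\in\mathcal{H}: 0\in A(x)+B(x)\}$ is nonempty. Let $v:\mathcal{H}\to\mathcal{H}$ be a mapping such that the pairs $(A,v)$ and $(B,v)$ are monotone, and let $\gamma>0$ be such that $\operatorname{ran}(\gamma B+v)=\mathcal{H}$. Suppose that the pair $(A,v)$ is $\alpha$-strongly monotone for some $\alpha>0$, that $A$ is $L$-Lipschitz continuous for some $L>0$, and that $$0<\gamma<\frac{2\alpha}{L^2}.$$ Let $(x_k)_{k\ge 0}$ be any sequence with $x_0\in\mathcal{H}$ and $$x_{k+1}\in(\gamma B+v)^{-1}\bigl(v(x_k)-\gamma A(x_k)\bigr),\qquad k\ge 0.$$ Then $(x_k)$ converges (in norm) to the unique element $x^*$ of $S$. Moreover: (a) If $v$ is Lipschitz continuous, then $(v(x_k))$ converges linearly to $v(x^* )$. (b) If both $v$ and $v^{-1}$ are Lipschitz continuous, then $(x_k)$ converges linearly to $x^*$.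
   Context: For a set-valued operator $F:\mathcal{H}\rightrightarrows\mathcal{H}$: $\operatorname{ran}F=\bigcup_{x\in\mathcal{H}}F(x)$ and $F^{-1}(y)=\{x\in\mathcal{H}: y\in F(x)\}$. A single-valued map is identified with the set-valued operator taking singleton values. A pair $(F_1,F_2)$ of operators $F_1,F_2:\mathcal{H}\rightrightarrows\mathcal{H}$ is monotone if $\langle x_1^*-y_1^*,x_2^*-y_2^*\rangle\ge 0$ for all $x,y\in\mathcal{H}$, $x_1^*\in F_1(x)$, $y_1^*\in F_1(y)$, $x_2^*\in F_2(x)$, $y_2^*\in F_2(y)$. It is $\alpha$-strongly monotone ($\alpha>0$) if, for all such choices, $\langle x_1^*-y_1^*,x_2^*-y_2^*\rangle\ge\alpha\|x-y\|^2$. "$v^{-1}$ is Lipschitz continuous" means that $v$ is injective and $v^{-1}:\operatorname{ran}v\to\mathcal{H}$ is Lipschitz continuous. A sequence $(z_k)$ converges linearly to $z$ if there are $C\ge 0$ and $q\in[0,1)$ such that $\|z_k-z\|\le Cq^k$ for all $k\ge 0$. *)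

theory Defs
  imports "HOL-Analysis.Analysis" "HOL-Library.Set_Algebras"
begin

type_synonym 'a set_op = "'a \<Rightarrow> 'a set"

definition single_op :: "('a \<Rightarrow> 'a) \<Rightarrow> 'a set_op" where
  "single_op f = (\<lambda>x. {f x})"

(* The sum on the right is the Minkowski sum of sets. *)
definition op_add :: "'a::plus set_op \<Rightarrow> 'a set_op \<Rightarrow> 'a set_op" where
  "op_add F G = (\<lambda>x. F x + G x)"

definition op_scale :: "real \<Rightarrow> 'a::real_vector set_op \<Rightarrow> 'a set_op" where
  "op_scale c F = (\<lambda>x. (\<lambda>y. c *\<^sub>R y) ` F x)"

definition op_ran :: "'a set_op \<Rightarrow> 'a set" where
  "op_ran F = (\<Union>x. F x)"

definition op_inverse :: "'a set_op \<Rightarrow> 'a set_op" where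
  "op_inverse F = (\<lambda>y. {x. y \<in> F x})"

definition monotone_pair :: "'a::real_inner set_op \<Rightarrow> 'a set_op \<Rightarrow> bool" where
  "monotone_pair F1 F2 \<longleftrightarrow>
     (\<forall>x y. \<forall>x1\<in>F1 x. \<forall>y1\<in>F1 y. \<forall>x2\<in>F2 x. \<forall>y2\<in>F2 y.
        inner (x1 - y1) (x2 - y2) \<ge> 0)"

definition strongly_monotone_pair ::
  "real \<Rightarrow> 'a::real_inner set_op \<Rightarrow> 'a set_op \<Rightarrow> bool" where
  "strongly_monotone_pair \<alpha> F1 F2 \<longleftrightarrow> \<alpha> > 0 \<and>
     (\<forall>x y. \<forall>x1\<in>F1 x. \<forall>y1\<in>F1 y. \<forall>x2\<in>F2 x. \<forall>y2\<in>F2 y.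
        inner (x1 - y1) (x2 - y2) \<ge> \<alpha> * (norm (x - y))\<^sup>2)"

definition solution_set :: "('a::real_vector \<Rightarrow> 'a) \<Rightarrow> 'a set_op \<Rightarrow> 'a set" where
  "solution_set A B = {x. 0 \<in> op_add (single_op A) B x}"

definition lipschitz_map :: "('a::metric_space \<Rightarrow> 'a) \<Rightarrow> bool" where
  "lipschitz_map v \<longleftrightarrow> (\<exists>K. K-lipschitz_on UNIV v)"

(* Injectivity is required, so that inv v is the genuine inverse on range v. *)
definition lipschitz_inverse :: "('a::metric_space \<Rightarrow> 'a) \<Rightarrow> bool" where
  "lipschitz_inverse v \<longleftrightarrow> inj v \<and> (\<exists>K. K-lipschitz_on (range v) (inv v))"

definition converges_linearly :: "(nat \<Rightarrow> 'a::real_normed_vector) \<Rightarrow> 'a \<Rightarrow> bool" where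
  "converges_linearly z l \<longleftrightarrow>
     (\<exists>C q. 0 \<le> C \<and> 0 \<le> q \<and> q < 1 \<and> (\<forall>k. norm (z k - l) \<le> C * q ^ k))"

end

theory Submission
  imports Defs
begin

text \<open>The quantity \<open>(norm (v (x k) - v s))\<^sup>2\<close>, for a solution \<open>s\<close>, is a Lyapunov function: monotonicity
  of \<open>(B, v)\<close> makes the backward step nonexpansive after applying \<open>v\<close>, and strong monotonicity of
  \<open>(A, v)\<close> makes the forward step lose at least
  \<open>\<gamma> * (2 * \<alpha> - \<gamma> * L\<^sup>2) * (norm (x k - s))\<^sup>2\<close>.\<close>

text \<open>A decreasing sequence bounded below converges, so its successive differences tend to
  zero, and these dominate \<open>e\<close>. The limit of \<open>f\<close> itself need not be
  known.\<close>

lemma tendsto_zero_if_dominated_by_decrease: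
  fixes f e :: "nat \<Rightarrow> real"
  assumes f: "\<And>k. 0 \<le> f k" and e: "\<And>k. 0 \<le> e k"
    and dec: "\<And>k. f (Suc k) + e k \<le> f k"
  shows "e \<longlonglongrightarrow> 0"
proof -
  have "f (Suc k) \<le> f k" for k
    using dec[of k] e[of k] by linarith
  then have "decseq f"
    by (simp add: decseq_Suc_iff)
  then obtain l where l: "f \<longlonglongrightarrow> l"
    using decseq_convergent[of f 0] f by blast
  have lim: "(\<lambda>k. f k - f (Suc k)) \<longlonglongrightarrow> 0"
    using tendsto_diff[OF l LIMSEQ_Suc[OF l]] by simp
  have le: "e k \<le> f k - f (Suc k)" for k
    using dec[of k] by linarith
  show ?thesis
    by (rule tendsto_sandwich[OF always_eventually always_eventually tendsto_const lim])
      (use e le in blast)+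
qed

text \<open>The energy estimates below are in squared norms, so a factor \<open>r\<close> there
  becomes the rate \<open>sqrt r\<close>.\<close>

lemma converges_linearly_if_contracting:
  assumes "0 \<le> r" "r < 1"
    and contr: "\<And>k. (norm (z (Suc k) - l))\<^sup>2 \<le> r * (norm (z k - l))\<^sup>2"
  shows "converges_linearly z l"
proof -
  have "norm (z k - l) \<le> norm (z 0 - l) * sqrt r ^ k" for k
  proof (induction k)
    case (Suc k)
    have "norm (z (Suc k) - l) \<le> sqrt r * norm (z k - l)"
      using real_sqrt_le_mono[OF contr[of k]] by (simp add: real_sqrt_mult)
    also have "\<dots> \<le> sqrt r * (norm (z 0 - l) * sqrt r ^ k)"
      using Suc \<open>0 \<le> r\<close> by (intro mult_left_mono) auto
    finally show ?case
      by (simp add: ac_simps)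
  qed simp
  then show ?thesis
    unfolding converges_linearly_def
    using assms by (intro exI[of _ "norm (z 0 - l)"] exI[of _ "sqrt r"]) auto
qed

lemma mem_solution_set_iff: "s \<in> solution_set A B \<longleftrightarrow> - A s \<in> B s"
proof -
  have "0 = A s + b \<longleftrightarrow> b = - A s" for b
    by (metis add.inverse_unique add.right_inverse)
  then show ?thesis
    by (simp add: solution_set_def op_add_def single_op_def set_plus_def)
qed

lemma mem_op_inverse_op_addE:
  assumes "y \<in> op_inverse (op_add (op_scale \<gamma> B) (single_op v)) w"
  obtains b where "b \<in> B y" "w = \<gamma> *\<^sub>R b + v y"
  using assms
  by (auto simp: op_inverse_def op_add_def op_scale_def single_op_def set_plus_def)

text \<open>Two solutions supply the elements \<open>- A s\<close> and \<open>- A t\<close> of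
  \<open>B\<close>. The sign change turns monotonicity of \<open>(B, v)\<close> into an upper bound
  on the very inner product that strong monotonicity of \<open>(A, v)\<close> bounds from
  below.\<close>

lemma solution_unique:
  assumes B: "monotone_pair B (single_op v)"
    and A: "strongly_monotone_pair \<alpha> (single_op A) (single_op v)"
    and s: "s \<in> solution_set A B" and t: "t \<in> solution_set A B"
  shows "s = t"
proof -
  have "- A s \<in> B s" "- A t \<in> B t"
    using s t by (simp_all add: mem_solution_set_iff)
  then have "0 \<le> inner (- A s - - A t) (v s - v t)"
    using B unfolding monotone_pair_def single_op_def by blast
  moreover have "\<alpha> * (norm (s - t))\<^sup>2 \<le> inner (A s - A t) (v s - v t)" and "\<alpha> > 0"
    using A by (simp_all add: strongly_monotone_pair_def single_op_def)
  ultimately have "\<alpha> * (norm (s - t))\<^sup>2 \<le> 0"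
    by (simp add: inner_diff_left)
  with \<open>\<alpha> > 0\<close> show ?thesis
    by (simp add: mult_le_0_iff)
qed

text \<open>Cauchy-Schwarz, divided by \<open>norm p\<close>. It gives the nonexpansiveness of the
  backward step, with \<open>p\<close> the displacement after that step and \<open>q\<close> the one
  before it.\<close>

lemma norm_le_if_diff_obtuse:
  fixes p q :: "'a::real_inner"
  assumes "0 \<le> inner (q - p) p"
  shows "norm p \<le> norm q"
proof (cases "p = 0")
  case False
  have "norm p * norm p \<le> inner q p"
    using assms by (simp add: inner_diff_left dot_square_norm power2_eq_square)
  also have "\<dots> \<le> norm q * norm p"
    by (rule norm_cauchy_schwarz)
  finally show ?thesis
    using False by simp
qed simp

lemma forward_backward_step:
  assumes B: "monotone_pair B (single_op v)"
    and A: "strongly_monotone_pair \<alpha> (single_op A) (single_op v)"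
    and lip: "L-lipschitz_on UNIV A"
    and "\<gamma> > 0"
    and s: "s \<in> solution_set A B"
    and y: "y \<in> op_inverse (op_add (op_scale \<gamma> B) (single_op v)) (v x - \<gamma> *\<^sub>R A x)"
  shows "(norm (v y - v s))\<^sup>2 + \<gamma> * (2 * \<alpha> - \<gamma> * L\<^sup>2) * (norm (x - s))\<^sup>2
    \<le> (norm (v x - v s))\<^sup>2"
proof -
  obtain b where b: "b \<in> B y" and eq: "v x - \<gamma> *\<^sub>R A x = \<gamma> *\<^sub>R b + v y"
    using y by (rule mem_op_inverse_op_addE)
  define d where "d = v x - v s"
  define a where "a = A x - A s"
  have "0 \<le> inner (b - - A s) (v y - v s)"
    using B b s unfolding monotone_pair_def mem_solution_set_iff single_op_def by blast
  \<comment> \<open>The solution \<open>s\<close> is a fixed point of the iteration: it satisfies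
    \<open>eq\<close> with \<open>s\<close> for both \<open>x\<close> and \<open>y\<close>, and
    \<open>- A s\<close> for \<open>b\<close>. Subtracting the two equations gives this one.\<close>
  moreover have "(d - \<gamma> *\<^sub>R a) - (v y - v s) = \<gamma> *\<^sub>R (b - - A s)"
    using eq by (simp add: d_def a_def algebra_simps)
  ultimately have "0 \<le> inner ((d - \<gamma> *\<^sub>R a) - (v y - v s)) (v y - v s)"
    using \<open>\<gamma> > 0\<close> by simp
  then have "(norm (v y - v s))\<^sup>2 \<le> (norm (d - \<gamma> *\<^sub>R a))\<^sup>2"
    by (intro power_mono norm_le_if_diff_obtuse) auto
  also have "\<dots> = (norm d)\<^sup>2 - 2 * \<gamma> * inner a d + \<gamma>\<^sup>2 * (norm a)\<^sup>2"
    unfolding power2_norm_eq_inner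
    by (simp add: inner_diff_left inner_diff_right inner_commute power2_eq_square)
  \<comment> \<open>Strong monotonicity controls the cross term, the Lipschitz bound on
    \<open>A\<close> the quadratic one.\<close>
  also have "\<dots> \<le> (norm d)\<^sup>2 - 2 * \<gamma> * (\<alpha> * (norm (x - s))\<^sup>2) + \<gamma>\<^sup>2 * (L\<^sup>2 * (norm (x - s))\<^sup>2)"
  proof -
    have "norm a \<le> L * norm (x - s)"
      using lipschitz_onD[OF lip, of x s] by (simp add: a_def dist_norm)
    then have "(norm a)\<^sup>2 \<le> L\<^sup>2 * (norm (x - s))\<^sup>2"
      using power_mono[of "norm a" "L * norm (x - s)" 2] by (simp add: power_mult_distrib)
    moreover have "\<alpha> * (norm (x - s))\<^sup>2 \<le> inner a d"
      using A by (simp add: strongly_monotone_pair_def single_op_def a_def d_def)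
    ultimately show ?thesis
      using \<open>\<gamma> > 0\<close> by (intro add_mono diff_mono mult_left_mono) auto
  qed
  finally show ?thesis
    by (simp add: d_def algebra_simps power2_eq_square)
qed

theorem theorem3p1:
  fixes A v :: "'a::{real_inner, complete_space} \<Rightarrow> 'a"
    and B :: "'a \<Rightarrow> 'a set"
    and \<alpha> L \<gamma> :: real
    and x :: "nat \<Rightarrow> 'a"
  assumes "solution_set A B \<noteq> {}"
    and "monotone_pair (single_op A) (single_op v)"
    and "monotone_pair B (single_op v)"
    and "\<gamma> > 0"
    and "op_ran (op_add (op_scale \<gamma> B) (single_op v)) = UNIV"
    and "\<alpha> > 0"
    and "strongly_monotone_pair \<alpha> (single_op A) (single_op v)"
    and "L > 0"
    and "L-lipschitz_on UNIV A"
    and "\<gamma> < 2 * \<alpha> / L\<^sup>2"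
    and "\<And>k. x (Suc k) \<in>
           op_inverse (op_add (op_scale \<gamma> B) (single_op v)) (v (x k) - \<gamma> *\<^sub>R A (x k))"
  shows "\<exists>xstar. solution_set A B = {xstar} \<and> x \<longlonglongrightarrow> xstar \<and>
           (lipschitz_map v \<longrightarrow> converges_linearly (\<lambda>k. v (x k)) (v xstar)) \<and>
           (lipschitz_map v \<and> lipschitz_inverse v \<longrightarrow> converges_linearly x xstar)"
proof -
  obtain s where s: "s \<in> solution_set A B"
    using assms(1) by blast
  define c where "c = \<gamma> * (2 * \<alpha> - \<gamma> * L\<^sup>2)"
  \<comment> \<open>The upper bound on the step size is exactly what makes the loss coefficient
    \<open>c\<close> positive.\<close>
  have "\<gamma> * L\<^sup>2 < 2 * \<alpha>"
    using assms(8,10) by (simp add: pos_less_divide_eq)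
  then have "c > 0"
    using assms(4) by (simp add: c_def)
  have step: "(norm (v (x (Suc k)) - v s))\<^sup>2 + c * (norm (x k - s))\<^sup>2 \<le> (norm (v (x k) - v s))\<^sup>2" for k
    using forward_backward_step[OF assms(3,7,9,4) s assms(11)] by (simp add: c_def)

  have "(\<lambda>k. c * (norm (x k - s))\<^sup>2) \<longlonglongrightarrow> 0"
    using step \<open>c > 0\<close>
    by (intro tendsto_zero_if_dominated_by_decrease[of "\<lambda>k. (norm (v (x k) - v s))\<^sup>2"]) auto
  then have "(\<lambda>k. (norm (x k - s))\<^sup>2) \<longlonglongrightarrow> 0"
    using tendsto_mult_left[of _ 0 _ "1 / c"] \<open>c > 0\<close> by fastforce
  then have "(\<lambda>k. norm (x k - s)) \<longlonglongrightarrow> 0"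
    using tendsto_real_sqrt by fastforce
  then have lim: "x \<longlonglongrightarrow> s"
    by (simp add: tendsto_norm_zero_iff LIM_zero_iff)

  \<comment> \<open>For Lipschitz \<open>v\<close> the Lyapunov function is at most
    \<open>M * (norm (x k - s))\<^sup>2\<close>, so each step loses at least the fraction
    \<open>c / M\<close> of its current value.\<close>
  have lin_v: "converges_linearly (\<lambda>k. v (x k)) (v s)" if v: "lipschitz_map v"
  proof -
    obtain K where K: "K-lipschitz_on UNIV v"
      using v unfolding lipschitz_map_def by blast
    define M where "M = K\<^sup>2 + c" \<comment> \<open>adding \<open>c\<close> ensures \<open>0 \<le> 1 - c / M\<close> and \<open>M \<noteq> 0\<close>\<close>
    have "M > 0" "c \<le> M"
      using \<open>c > 0\<close> by (simp_all add: M_def add_nonneg_pos)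
    show ?thesis
    proof (rule converges_linearly_if_contracting)
      show "0 \<le> 1 - c / M" "1 - c / M < 1"
        using \<open>c > 0\<close> \<open>M > 0\<close> \<open>c \<le> M\<close> by simp_all
      fix k
      have "norm (v (x k) - v s) \<le> K * norm (x k - s)"
        using lipschitz_onD[OF K, of "x k" s] by (simp add: dist_norm)
      then have "(norm (v (x k) - v s))\<^sup>2 \<le> K\<^sup>2 * (norm (x k - s))\<^sup>2"
        using power_mono[of "norm (v (x k) - v s)" "K * norm (x k - s)" 2] by (simp add: power_mult_distrib)
      also have "\<dots> \<le> M * (norm (x k - s))\<^sup>2"
        using \<open>c > 0\<close> by (intro mult_right_mono) (auto simp: M_def)
      finally have "c / M * (norm (v (x k) - v s))\<^sup>2 \<le> c / M * (M * (norm (x k - s))\<^sup>2)"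
        using \<open>c > 0\<close> \<open>M > 0\<close> by (intro mult_left_mono) auto
      also have "\<dots> = c * (norm (x k - s))\<^sup>2"
        using \<open>M > 0\<close> by simp
      finally show "(norm (v (x (Suc k)) - v s))\<^sup>2 \<le> (1 - c / M) * (norm (v (x k) - v s))\<^sup>2"
        using step[of k] by (simp add: left_diff_distrib)
    qed
  qed

  \<comment> \<open>The Lipschitz inverse carries the estimate for \<open>v (x k)\<close> back to
    \<open>x k\<close>: the rate \<open>q\<close> is kept and only the constant grows by the factor
    \<open>K\<close>.\<close>
  have lin_x: "converges_linearly x s" if v: "lipschitz_map v" "lipschitz_inverse v"
  proof -
    obtain K where "inj v" and K: "K-lipschitz_on (range v) (inv v)"
      using v(2) unfolding lipschitz_inverse_def by blast
    have "K \<ge> 0"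
      using K by (rule lipschitz_on_nonneg)
    obtain C q where q: "0 \<le> C" "0 \<le> q" "q < 1"
      and bound: "\<And>k. norm (v (x k) - v s) \<le> C * q ^ k"
      using lin_v[OF v(1)] unfolding converges_linearly_def by blast
    have "norm (x k - s) \<le> K * C * q ^ k" for k
    proof -
      have "norm (x k - s) \<le> K * norm (v (x k) - v s)"
        using lipschitz_onD[OF K, of "v (x k)" "v s"] \<open>inj v\<close> by (simp add: dist_norm)
      also have "\<dots> \<le> K * (C * q ^ k)"
        using bound \<open>K \<ge> 0\<close> by (rule mult_left_mono)
      finally show ?thesis
        by (simp add: mult.assoc)
    qed
    then show ?thesis
      unfolding converges_linearly_def
      using q \<open>K \<ge> 0\<close> by (intro exI[of _ "K * C"] exI[of _ q]) auto
  qed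

  have "solution_set A B = {s}"
    using solution_unique[OF assms(3,7)] s by blast
  then show ?thesis
    using lim lin_v lin_x by blast
qed

end
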